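(* The function $\mathfrak{H}_{\mathbb{Z}}:(\mathcal{COS}(\mathbb{Z}),\tau_{ucc})\to S^1_+\cup\{1\}$ given by the formula $$\mathfrak{H}_{\mathbb{Z}}\left(k\mapsto\frac{z^k+z^{-k}}{2}\right):=z$$ (where $z\in S^1_+\cup\{1\}$) is a homeomorphism.
   Context: With $C^b(\mathbb{Z})$ the space of bounded functions $\mathbb{Z}\to\mathbb{C}$ ($\mathbb{Z}$ is discrete), the cosine class is $$\mathcal{COS}(\mathbb{Z}) := \left\{\phi\in C^b(\mathbb{Z}) : \phi\neq 0,\ \forall_{k,l\in\mathbb{Z}}\ \phi(k)\phi(l)=\frac{\phi(k+l)+\phi(k-l)}{2}\right\},$$ and $\tau_{ucc}$ is the topology of uniform convergence on compact (i.e. finite) subsets of $\mathbb{Z}$. $S^1=\{z\in\mathbb{C}:|z|=1\}$ and $S^1_+:=\{z\in S^1:\operatorname{Im}(z)>0\}$; $S^1_+\cup\{1\}$ carries the topology inherited from $\mathbb{C}$.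
   Formalization: The target and parameter set S^1_+ ∪ {1} is corrected to S^1_+ ∪ {1, -1}: the function k ↦ (-1)^k lies in COS(Z) and comes only from z = -1, so the printed formula does not define a map on all of COS(Z). *)

theory Defs
  imports "HOL-Analysis.Analysis"
begin

(* A set U of functions is open iff around each of its members f it contains a basic
   neighbourhood {g. dist (f x) (g x) < e for all x in K} with K compact and e > 0. *)
definition ucc_open :: "('a::topological_space \<Rightarrow> 'b::metric_space) set \<Rightarrow> bool" where
  "ucc_open U \<longleftrightarrow>
     (\<forall>f\<in>U. \<exists>K e. compact K \<and> e > 0 \<and> {g. \<forall>x\<in>K. dist (f x) (g x) < e} \<subseteq> U)"

lemma istopology_ucc_open: "istopology ucc_open"
  unfolding istopology_def
proof (intro conjI allI impI)
  fix U V :: "('a \<Rightarrow> 'b) set"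
  assume U: "ucc_open U" and V: "ucc_open V"
  show "ucc_open (U \<inter> V)"
    unfolding ucc_open_def
  proof
    fix f assume "f \<in> U \<inter> V"
    then have f: "f \<in> U" "f \<in> V"
      by simp_all
    obtain K d where K: "compact K" "d > 0" "{g. \<forall>x\<in>K. dist (f x) (g x) < d} \<subseteq> U"
      using bspec[OF U[unfolded ucc_open_def] f(1)] by (elim exE conjE)
    obtain L e where L: "compact L" "e > 0" "{g. \<forall>x\<in>L. dist (f x) (g x) < e} \<subseteq> V"
      using bspec[OF V[unfolded ucc_open_def] f(2)] by (elim exE conjE)
    have "{g. \<forall>x\<in>K \<union> L. dist (f x) (g x) < min d e}
        \<subseteq> {g. \<forall>x\<in>K. dist (f x) (g x) < d} \<inter> {g. \<forall>x\<in>L. dist (f x) (g x) < e}"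
      by auto
    also have "\<dots> \<subseteq> U \<inter> V"
      using K(3) L(3) by (rule Int_mono)
    finally have "compact (K \<union> L) \<and> min d e > 0 \<and>
        {g. \<forall>x\<in>K \<union> L. dist (f x) (g x) < min d e} \<subseteq> U \<inter> V"
      using K(1,2) L(1,2) by (simp add: compact_Un)
    then show "\<exists>K e. compact K \<and> e > 0 \<and> {g. \<forall>x\<in>K. dist (f x) (g x) < e} \<subseteq> U \<inter> V"
      by (intro exI)
  qed
next
  fix \<U> :: "('a \<Rightarrow> 'b) set set"
  assume *: "\<forall>U\<in>\<U>. ucc_open U"
  show "ucc_open (\<Union>\<U>)"
    unfolding ucc_open_def
  proof
    fix f assume "f \<in> \<Union>\<U>"
    then obtain U where U: "U \<in> \<U>" "f \<in> U"
      by blast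
    have "ucc_open U"
      using * U(1) by (rule bspec)
    then obtain K e where "compact K" "e > 0" "{g. \<forall>x\<in>K. dist (f x) (g x) < e} \<subseteq> U"
      using bspec[OF \<open>ucc_open U\<close>[unfolded ucc_open_def] U(2)] by (elim exE conjE)
    moreover have "U \<subseteq> \<Union>\<U>"
      using U(1) by (rule Union_upper)
    ultimately show "\<exists>K e. compact K \<and> e > 0 \<and> {g. \<forall>x\<in>K. dist (f x) (g x) < e} \<subseteq> \<Union>\<U>"
      by (intro exI[of _ K] exI[of _ e] conjI subset_trans[OF _ \<open>U \<subseteq> \<Union>\<U>\<close>])
  qed
qed

definition ucc_topology :: "('a::topological_space \<Rightarrow> 'b::metric_space) topology" where
  "ucc_topology = topology ucc_open"

lemma openin_ucc_topology: "openin ucc_topology U \<longleftrightarrow> ucc_open U"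
  by (simp add: ucc_topology_def istopology_ucc_open)

definition COS_Z :: "(int \<Rightarrow> complex) set" where
  "COS_Z = {\<phi> \<in> bcontfun. \<phi> \<noteq> (\<lambda>_. 0) \<and>
     (\<forall>k l. \<phi> k * \<phi> l = (\<phi> (k + l) + \<phi> (k - l)) / 2)}"

definition upper_arc :: "complex set" where
  "upper_arc = {z \<in> sphere 0 1. Im z > 0}"

definition cos_fun :: "complex \<Rightarrow> int \<Rightarrow> complex" where
  "cos_fun z = (\<lambda>k. (z powi k + z powi (- k)) / 2)"

(* Both endpoints 1 and -1 of the arc are parameters.  The endpoint -1 cannot be omitted:
   see cos_fun_minus_one below. *)
definition H_Z :: "(int \<Rightarrow> complex) \<Rightarrow> complex" where
  "H_Z \<phi> = (THE z. z \<in> upper_arc \<union> {1, -1} \<and> \<phi> = cos_fun z)"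

(* The alternating function belongs to the cosine class but has no parameter in
   upper_arc \<union> {1}, so the formula for H_Z with parameters restricted to that set would
   not define it on the whole cosine class. *)
lemma cos_fun_minus_one:
  shows "cos_fun (-1) \<in> COS_Z" and "cos_fun (-1) \<notin> cos_fun ` (upper_arc \<union> {1})"
proof -
  have inv: "(- 1 :: complex) powi (- k) = (- 1) powi k" for k
    by (simp add: power_int_minus_one_minus)
  have eq: "cos_fun (- 1) = (\<lambda>k. (- 1) powi k)"
    by (simp add: cos_fun_def inv)
  have "bounded (range (\<lambda>k::int. (- 1 :: complex) powi k))"
    unfolding bounded_iff by (auto intro!: exI[of _ 1] simp: norm_power_int)
  moreover have "(- 1 :: complex) powi k * (- 1) powi l
      = ((- 1) powi (k + l) + (- 1) powi (k - l)) / 2" for k l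
  proof -
    have "(- 1 :: complex) powi (k + l) = (- 1) powi k * (- 1) powi l"
      by (simp add: power_int_add)
    moreover have "(- 1 :: complex) powi (k - l) = (- 1) powi k * (- 1) powi l"
      using power_int_add[of "- 1 :: complex" k "- l"] by (simp add: inv)
    ultimately show ?thesis by simp
  qed
  moreover have "(\<lambda>k::int. (- 1 :: complex) powi k) \<noteq> (\<lambda>_. 0)"
    by (auto simp: fun_eq_iff)
  moreover have "continuous_on UNIV (\<lambda>k::int. (- 1 :: complex) powi k)"
    by (simp add: continuous_on_discrete)
  ultimately show "cos_fun (-1) \<in> COS_Z"
    by (simp add: COS_Z_def eq bcontfun_def)
  show "cos_fun (-1) \<notin> cos_fun ` (upper_arc \<union> {1})"
  proof
    assume "cos_fun (-1) \<in> cos_fun ` (upper_arc \<union> {1})"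
    then obtain z where z: "z \<in> upper_arc \<union> {1}" "cos_fun z = cos_fun (-1)"
      by (elim imageE) simp
    then have "z \<noteq> 0"
      by (auto simp: upper_arc_def)
    have "(z + inverse z) / 2 = - 1"
      using fun_cong[OF z(2), of 1] by (simp add: cos_fun_def power_int_minus)
    then have "z + inverse z = - 2"
      by (simp add: divide_eq_eq)
    then have "z * (z + inverse z + 2) = 0"
      by simp
    moreover have "z * (z + inverse z + 2) = (z + 1)\<^sup>2"
      using \<open>z \<noteq> 0\<close> by (simp add: algebra_simps power2_eq_square)
    ultimately have "(z + 1)\<^sup>2 = 0"
      by (simp only:)
    then have "z + 1 = 0"
      by simp
    then have "z = - 1"
      by (rule eq_neg_iff_add_eq_0[THEN iffD2])
    with z(1) show False
      by (auto simp: upper_arc_def)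
  qed
qed

end

theory Submission
  imports Defs
begin

text \<open>
  The defining identity of the cosine class, taken at \<open>l = 1\<close>, is the three-term recurrence
  \<open>\<phi> (k + 1) = 2 \<phi> 1 \<phi> k - \<phi> (k - 1)\<close>.  As \<open>\<phi>\<close> is even with \<open>\<phi> 0 = 1\<close>, the single number \<open>\<phi> 1\<close>
  determines \<open>\<phi>\<close> (\<open>dalembert_determined_by_value_at_1\<close>).  Every complex number is of the form
  \<open>(z + inverse z) / 2\<close>, and \<open>cos_fun z\<close> solves the same recurrence, so \<open>\<phi> = cos_fun z\<close> for some
  \<open>z \<noteq> 0\<close>.  If \<open>z\<close> were off the unit circle, \<open>z\<close> or its inverse would have modulus above 1 and
  its powers would make \<open>\<phi>\<close> unbounded; so \<open>norm z = 1\<close>, and replacing \<open>z\<close> by \<open>inverse z = cnj z\<close>,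
  which leaves \<open>cos_fun z\<close> unchanged, moves \<open>z\<close> into the closed upper half of the circle.

  There \<open>cos_fun z 1 = Re z\<close>, and a point of the closed upper half circle is a continuous function
  of its real part, namely \<open>x \<mapsto> Complex x (sqrt (1 - x\<^sup>2))\<close>.  This gives uniqueness of \<open>z\<close>, and
  continuity of \<open>H_Z\<close> because evaluation at the point 1 is continuous.  The inverse \<open>cos_fun\<close>
  is continuous because compact sets of integers are finite, so that it suffices to
  have continuity of \<open>z \<mapsto> cos_fun z k\<close> for each \<open>k\<close> separately.
\<close>

section \<open>Uniform convergence on compact sets\<close>

lemma topspace_ucc_topology: "topspace ucc_topology = UNIV"
proof -
  have "openin ucc_topology UNIV"
    unfolding openin_ucc_topology ucc_open_def
    by (auto intro!: exI[of _ "{}"] exI[of _ "1::real"])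
  then show ?thesis
    by (rule top.extremum_uniqueI[OF openin_subset])
qed

lemma continuous_map_ucc_eval:
  "continuous_map ucc_topology euclidean (\<lambda>f::'a::topological_space \<Rightarrow> 'b::metric_space. f x)"
proof -
  have "ucc_open {f :: 'a \<Rightarrow> 'b. f x \<in> U}" if "open U" for U
    unfolding ucc_open_def
  proof
    fix f :: "'a \<Rightarrow> 'b"
    assume "f \<in> {f. f x \<in> U}"
    then obtain e where "e > 0" "\<And>y. dist y (f x) < e \<Longrightarrow> y \<in> U"
      using \<open>open U\<close> unfolding open_dist by blast
    then have "compact {x} \<and> e > 0 \<and> {g. \<forall>y\<in>{x}. dist (f y) (g y) < e} \<subseteq> {f. f x \<in> U}"
      by (auto simp: dist_commute)
    then show "\<exists>K e. compact K \<and> e > 0 \<and> {g. \<forall>y\<in>K. dist (f y) (g y) < e} \<subseteq> {f. f x \<in> U}"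
      by (intro exI)
  qed
  then show ?thesis
    by (simp add: continuous_map openin_ucc_topology topspace_ucc_topology)
qed

text \<open>In a discrete space compact sets are finite, hence uniform convergence on compact sets is
  pointwise convergence.\<close>

lemma continuous_map_into_ucc_discrete:
  fixes f :: "'c::topological_space \<Rightarrow> 'a::discrete_topology \<Rightarrow> 'b::metric_space"
  assumes cont: "\<And>x. continuous_on S (\<lambda>s. f s x)"
  shows "continuous_map (top_of_set S) ucc_topology f"
proof -
  have "openin (top_of_set S) {s \<in> S. f s \<in> U}" if U: "ucc_open U" for U
  proof (subst openin_subopen, safe)
    fix s assume s: "s \<in> S" "f s \<in> U"
    then obtain K e where K: "compact K" "e > 0" "{g. \<forall>x\<in>K. dist (f s x) (g x) < e} \<subseteq> U"
      using bspec[OF U[unfolded ucc_open_def] s(2)] by (elim exE conjE)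
    have "finite K"
    proof -
      obtain D where "D \<subseteq> K" "finite D" "K \<subseteq> (\<Union>x\<in>D. {x})"
        by (rule compactE_image[OF \<open>compact K\<close>, of K "\<lambda>x. {x}"]) (auto simp: open_discrete)
      then show ?thesis
        by (simp add: finite_subset)
    qed
    have "\<forall>\<^sub>F t in at s within S. \<forall>x\<in>K. dist (f s x) (f t x) < e"
    proof (intro eventually_ball_finite[OF \<open>finite K\<close>] ballI)
      fix x
      have "((\<lambda>t. f t x) \<longlongrightarrow> f s x) (at s within S)"
        using cont s(1) by (auto simp: continuous_on_def)
      from tendstoD[OF this \<open>e > 0\<close>] show "\<forall>\<^sub>F t in at s within S. dist (f s x) (f t x) < e"
        by (simp add: dist_commute)
    qed
    then obtain T where T: "open T" "s \<in> T"
      "\<And>t. t \<in> T \<Longrightarrow> t \<noteq> s \<Longrightarrow> t \<in> S \<Longrightarrow> \<forall>x\<in>K. dist (f s x) (f t x) < e"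
      unfolding eventually_at_topological by blast
    have "S \<inter> T \<subseteq> {s \<in> S. f s \<in> U}"
    proof
      fix t assume t: "t \<in> S \<inter> T"
      show "t \<in> {s \<in> S. f s \<in> U}"
      proof (cases "t = s")
        case False
        then have "f t \<in> {g. \<forall>x\<in>K. dist (f s x) (g x) < e}"
          using T(3)[of t] t by simp
        then show ?thesis
          using subsetD[OF K(3)] t by simp
      qed (use s in simp)
    qed
    then show "\<exists>T. openin (top_of_set S) T \<and> s \<in> T \<and> T \<subseteq> {s \<in> S. f s \<in> U}"
      using T(1,2) s(1) by (intro exI[of _ "S \<inter> T"]) (auto simp: openin_open)
  qed
  then show ?thesis
    by (simp add: continuous_map openin_ucc_topology topspace_ucc_topology)
qed

section \<open>Solutions of the cosine functional equation\<close>

definition dalembert :: "(int \<Rightarrow> 'a::field_char_0) \<Rightarrow> bool" where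
  "dalembert \<phi> \<longleftrightarrow> (\<forall>k l. \<phi> k * \<phi> l = (\<phi> (k + l) + \<phi> (k - l)) / 2)"

lemma dalembert_at_0:
  assumes "dalembert \<phi>" "\<phi> \<noteq> (\<lambda>_. 0)"
  shows "\<phi> 0 = 1"
proof -
  obtain k where "\<phi> k \<noteq> 0"
    using assms(2) by auto
  moreover have "\<phi> k * \<phi> 0 = (\<phi> (k + 0) + \<phi> (k - 0)) / 2"
    using assms(1) unfolding dalembert_def by blast
  ultimately show ?thesis
    by simp
qed

lemma dalembert_even:
  assumes "dalembert \<phi>" "\<phi> 0 = 1"
  shows "\<phi> (- k) = \<phi> k"
proof -
  have "\<phi> 0 * \<phi> k = (\<phi> (0 + k) + \<phi> (0 - k)) / 2"
    using assms(1) unfolding dalembert_def by blast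
  then show ?thesis
    using assms(2) by (simp add: field_simps)
qed

lemma dalembert_recurrence:
  assumes "dalembert \<phi>"
  shows "\<phi> (k + 1) = 2 * \<phi> k * \<phi> 1 - \<phi> (k - 1)"
proof -
  have "\<phi> k * \<phi> 1 = (\<phi> (k + 1) + \<phi> (k - 1)) / 2"
    using assms unfolding dalembert_def by blast
  then show ?thesis
    by (simp add: field_simps)
qed

lemma dalembert_determined_by_value_at_1:
  assumes \<phi>: "dalembert \<phi>" "\<phi> 0 = 1" and \<psi>: "dalembert \<psi>" "\<psi> 0 = 1" and "\<phi> 1 = \<psi> 1"
  shows "\<phi> = \<psi>"
proof
  \<comment> \<open>The recurrence looks back two steps, so two consecutive values are carried along.\<close>
  have "\<phi> (int n) = \<psi> (int n) \<and> \<phi> (int n + 1) = \<psi> (int n + 1)" for n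
  proof (induction n)
    case 0
    then show ?case
      using assms by simp
  next
    case (Suc n)
    then have "\<phi> (int n + 1 + 1) = \<psi> (int n + 1 + 1)"
      unfolding dalembert_recurrence[OF \<phi>(1), of "int n + 1"]
        dalembert_recurrence[OF \<psi>(1), of "int n + 1"] using assms(5) by simp
    then show ?case
      using Suc by (simp add: add.commute)
  qed
  then have nat: "\<phi> (int n) = \<psi> (int n)" for n
    by blast
  fix k
  show "\<phi> k = \<psi> k"
  proof (cases "k \<ge> 0")
    case True
    then show ?thesis
      using nat[of "nat k"] by simp
  next
    case False
    then show ?thesis
      using nat[of "nat (- k)"] dalembert_even[OF \<phi>, of k] dalembert_even[OF \<psi>, of k] by simp
  qed
qed

lemma dalembert_cos_fun:
  assumes "z \<noteq> 0"
  shows "dalembert (cos_fun z)"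
  unfolding dalembert_def
proof (intro allI)
  fix k l
  define a b where "a = z powi k" and "b = z powi l"
  have "a \<noteq> 0" "b \<noteq> 0"
    using assms by (simp_all add: a_def b_def)
  moreover have "z powi (k + l) = a * b" "z powi (k - l) = a / b"
      "z powi (- (k + l)) = 1 / (a * b)" "z powi (- (k - l)) = b / a"
      "z powi (- k) = 1 / a" "z powi (- l) = 1 / b"
    using assms unfolding power_int_minus
    by (simp_all add: a_def b_def power_int_add power_int_diff inverse_eq_divide)
  moreover have "(a + 1 / a) / 2 * ((b + 1 / b) / 2)
      = ((a * b + 1 / (a * b)) / 2 + (a / b + b / a) / 2) / 2"
    using \<open>a \<noteq> 0\<close> \<open>b \<noteq> 0\<close> by (simp add: field_simps)
  ultimately show "cos_fun z k * cos_fun z l = (cos_fun z (k + l) + cos_fun z (k - l)) / 2"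
    unfolding cos_fun_def a_def[symmetric] b_def[symmetric] by (simp only:)
qed

lemma cos_fun_0: "cos_fun z 0 = 1"
  by (simp add: cos_fun_def)

lemma cos_fun_inverse: "cos_fun (inverse z) = cos_fun z"
  by (simp add: cos_fun_def power_int_inverse power_int_minus fun_eq_iff add.commute)

lemma exists_eq_half_add_inverse:
  obtains z :: complex where "z \<noteq> 0" "(z + inverse z) / 2 = c"
proof
  \<comment> \<open>\<open>c + s\<close> and \<open>c - s\<close> are the roots of \<open>X\<^sup>2 - 2 c X + 1\<close>, whose product is 1.\<close>
  define s where "s = csqrt (c\<^sup>2 - 1)"
  have prod: "(c + s) * (c - s) = 1"
    by (simp add: s_def algebra_simps flip: power2_eq_square)
  then show "c + s \<noteq> 0"
    by auto
  have "inverse (c + s) = c - s"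
    using prod by (rule inverse_unique)
  then show "((c + s) + inverse (c + s)) / 2 = c"
    by simp
qed

text \<open>For \<open>norm z > 1\<close> the summand \<open>z ^ n\<close> blows up while \<open>z powi (- n)\<close> stays in the unit disc.\<close>

lemma norm_le_1_if_bounded_cos_fun:
  assumes "bounded (range (cos_fun z))"
  shows "norm z \<le> 1"
proof (rule ccontr)
  assume "\<not> norm z \<le> 1"
  then have z: "norm z > 1"
    by simp
  obtain B where B: "norm (cos_fun z k) \<le> B" for k
    using assms unfolding bounded_iff by auto
  obtain n where n: "2 * B + 1 < norm z ^ n"
    using real_arch_pow[OF z] by blast
  have "norm (z powi (- int n)) \<le> 1"
    using z by (simp add: power_int_minus norm_inverse norm_power inverse_le_1_iff one_le_power)
  moreover have "z ^ n = 2 * cos_fun z (int n) - z powi (- int n)"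
    by (simp add: cos_fun_def field_simps)
  then have "norm z ^ n \<le> 2 * norm (cos_fun z (int n)) + norm (z powi (- int n))"
    using norm_triangle_ineq4[of "2 * cos_fun z (int n)" "z powi (- int n)"]
    by (simp add: norm_mult flip: norm_power)
  ultimately show False
    using n B[of "int n"] by simp
qed

section \<open>Parameters on the closed upper half circle\<close>

lemma mem_closed_upper_arc_iff: "z \<in> upper_arc \<union> {1, -1} \<longleftrightarrow> norm z = 1 \<and> Im z \<ge> 0"
proof
  assume z: "norm z = 1 \<and> Im z \<ge> 0"
  show "z \<in> upper_arc \<union> {1, -1}"
  proof (cases "Im z = 0")
    case True
    then have "\<bar>Re z\<bar> = 1"
      using z by (simp add: cmod_def)
    then show ?thesis
      using True by (auto simp: complex_eq_iff)
  qed (use z in \<open>auto simp: upper_arc_def\<close>)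
qed (auto simp: upper_arc_def)

lemma cos_fun_at_1:
  assumes "norm z = 1"
  shows "cos_fun z 1 = of_real (Re z)"
proof -
  have "inverse z = cnj z"
    using assms by (simp add: inverse_complex_def complex_eq_iff cmod_power2[symmetric])
  then show ?thesis
    by (simp add: cos_fun_def power_int_minus complex_eq_iff)
qed

definition arc_point :: "real \<Rightarrow> complex" where
  "arc_point x = Complex x (sqrt (1 - x\<^sup>2))"

lemma arc_point_Re:
  assumes "norm z = 1" "Im z \<ge> 0"
  shows "arc_point (Re z) = z"
proof -
  have "1 - (Re z)\<^sup>2 = (Im z)\<^sup>2"
    using assms(1) cmod_power2[of z] by simp
  then show ?thesis
    using assms(2) by (simp add: arc_point_def complex_eq_iff)
qed

lemma continuous_on_arc_point: "continuous_on UNIV arc_point"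
  unfolding arc_point_def by (intro continuous_intros)

text \<open>An explicit left inverse of \<open>cos_fun\<close>, from which uniqueness of the parameter and a continuous
  formula for \<open>H_Z\<close> both follow.\<close>

lemma arc_point_cos_fun:
  assumes "z \<in> upper_arc \<union> {1, -1}"
  shows "arc_point (Re (cos_fun z 1)) = z"
  using assms unfolding mem_closed_upper_arc_iff by (simp add: cos_fun_at_1 arc_point_Re)

lemma cos_fun_in_COS_Z:
  assumes "norm z = 1"
  shows "cos_fun z \<in> COS_Z"
proof -
  have "norm (cos_fun z k) \<le> 1" for k
    using norm_triangle_ineq[of "z powi k" "z powi (- k)"] assms
    by (simp add: cos_fun_def norm_power_int norm_divide)
  then have "cos_fun z \<in> bcontfun"
    by (auto simp: bcontfun_def bounded_iff)
  moreover have "cos_fun z \<noteq> (\<lambda>_. 0)"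
    using cos_fun_0[of z] by force
  moreover have "dalembert (cos_fun z)"
    using assms by (intro dalembert_cos_fun) auto
  ultimately show ?thesis
    by (simp add: COS_Z_def dalembert_def)
qed

lemma COS_Z_parameter:
  assumes "\<phi> \<in> COS_Z"
  obtains z where "z \<in> upper_arc \<union> {1, -1}" "\<phi> = cos_fun z"
proof -
  have d: "dalembert \<phi>" and nz: "\<phi> \<noteq> (\<lambda>_. 0)" and bdd: "bounded (range \<phi>)"
    using assms by (auto simp: COS_Z_def dalembert_def bcontfun_def)
  obtain z where z: "z \<noteq> 0" "(z + inverse z) / 2 = \<phi> 1"
    by (rule exists_eq_half_add_inverse)
  have eq: "\<phi> = cos_fun z"
    using d dalembert_at_0[OF d nz] dalembert_cos_fun[OF z(1)] cos_fun_0
    by (rule dalembert_determined_by_value_at_1) (use z(2) in \<open>simp add: cos_fun_def power_int_minus\<close>)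
  have "norm z \<le> 1" "norm (inverse z) \<le> 1"
    using bdd by (auto intro!: norm_le_1_if_bounded_cos_fun simp only: eq cos_fun_inverse)
  then have norm: "norm z = 1"
    using z(1) by (simp add: norm_inverse inverse_le_1_iff)
  \<comment> \<open>Inversion is complex conjugation on the circle, so \<open>z\<close> or its inverse lies in the upper half.\<close>
  show thesis
  proof (cases "Im z \<ge> 0")
    case True
    then show ?thesis
      using that[of z] norm eq mem_closed_upper_arc_iff by blast
  next
    case False
    then have "Im (inverse z) \<ge> 0"
      by (simp add: divide_nonpos_nonneg)
    moreover have "norm (inverse z) = 1"
      using norm by (simp add: norm_inverse)
    ultimately show ?thesis
      using that[of "inverse z"] eq cos_fun_inverse[of z] mem_closed_upper_arc_iff by metis
  qed
qed

lemma H_Z_cos_fun: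
  assumes "z \<in> upper_arc \<union> {1, -1}"
  shows "H_Z (cos_fun z) = z"
  unfolding H_Z_def using assms by (intro the_equality) (simp, metis arc_point_cos_fun)

lemma H_Z_eq_arc_point:
  assumes "\<phi> \<in> COS_Z"
  shows "H_Z \<phi> = arc_point (Re (\<phi> 1))"
  using COS_Z_parameter[OF assms] H_Z_cos_fun arc_point_cos_fun by metis

theorem theorem9:
  shows "(\<forall>\<phi>\<in>COS_Z. \<exists>!z. z \<in> upper_arc \<union> {1, -1} \<and> \<phi> = cos_fun z) \<and>
    (\<forall>z\<in>upper_arc \<union> {1, -1}. cos_fun z \<in> COS_Z \<and> H_Z (cos_fun z) = z) \<and>
    homeomorphic_map (subtopology ucc_topology COS_Z) (top_of_set (upper_arc \<union> {1, -1})) H_Z"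
proof (intro conjI ballI)
  let ?A = "upper_arc \<union> {1, -1 :: complex}"
  fix \<phi> assume "\<phi> \<in> COS_Z"
  then show "\<exists>!z. z \<in> ?A \<and> \<phi> = cos_fun z"
    by (metis COS_Z_parameter arc_point_cos_fun)
next
  fix z assume "z \<in> upper_arc \<union> {1, -1 :: complex}"
  then show "cos_fun z \<in> COS_Z" "H_Z (cos_fun z) = z"
    using mem_closed_upper_arc_iff cos_fun_in_COS_Z H_Z_cos_fun by blast+
next
  let ?A = "upper_arc \<union> {1, -1 :: complex}"
  have in_COS: "cos_fun z \<in> COS_Z" if "z \<in> ?A" for z
    using that mem_closed_upper_arc_iff cos_fun_in_COS_Z by blast
  have H_in: "H_Z \<phi> \<in> ?A" and cos_H: "cos_fun (H_Z \<phi>) = \<phi>" if "\<phi> \<in> COS_Z" for \<phi>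
    using COS_Z_parameter[OF that] H_Z_cos_fun by metis+
  have "continuous_map (subtopology ucc_topology COS_Z) euclidean H_Z"
  proof (rule continuous_map_eq)
    have "continuous_map euclidean euclidean (\<lambda>w. arc_point (Re w))"
      by (auto intro!: continuous_on_compose2[OF continuous_on_arc_point] continuous_intros)
    from continuous_map_compose[OF continuous_map_ucc_eval this]
    show "continuous_map (subtopology ucc_topology COS_Z) euclidean (\<lambda>\<phi>. arc_point (Re (\<phi> 1)))"
      by (auto simp: o_def intro: continuous_map_from_subtopology)
  qed (simp add: H_Z_eq_arc_point)
  then have H: "continuous_map (subtopology ucc_topology COS_Z) (top_of_set ?A) H_Z"
    using H_in by (auto simp: continuous_map_in_subtopology)
  have "continuous_on ?A (\<lambda>z. cos_fun z k)" for k
    unfolding cos_fun_def by (intro continuous_intros) (auto simp: upper_arc_def)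
  then have "continuous_map (top_of_set ?A) (subtopology ucc_topology COS_Z) cos_fun"
    using in_COS by (auto simp: continuous_map_in_subtopology intro!: continuous_map_into_ucc_discrete)
  with H have "homeomorphic_maps (subtopology ucc_topology COS_Z) (top_of_set ?A) H_Z cos_fun"
    unfolding homeomorphic_maps_def using cos_H H_Z_cos_fun by auto
  then show "homeomorphic_map (subtopology ucc_topology COS_Z) (top_of_set ?A) H_Z"
    by (rule homeomorphic_maps_map[THEN iffD1, THEN conjunct1])
qed

end
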